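(* Let $A:\mathbb{R}^n\to\mathbb{R}^m$ be linear, $\mathcal{C}\subseteq\mathbb{R}^n$ a nonempty closed convex set, $f:\mathbb{R}^n\to\mathbb{R}$ continuously differentiable, and $g:\mathbb{R}^m\to\mathbb{R}\cup\{\infty\}$ polyhedral convex, with $\mathrm{dom}\,g\cap A(\mathrm{ri}(\mathcal{C}))\neq\emptyset$. Let $(\bar x,\bar\lambda)\in\mathbb{R}^n\times\mathbb{R}^m$ satisfy: (i) $0\in\partial\delta_{\mathcal{C}}(\bar x)+\nabla f(\bar x)+A^\top\bar\lambda$ and $\bar\lambda\in\partial g(A\bar x)$; (ii) there exists a convex neighborhood $U_{\bar x}$ of $\bar x$ on which $\nabla^2 f$ exists and is continuous, and $\nabla^2 f(\bar x)$ is positive definite relative to the subspace $V_{\mathcal{C}}\cap\mathcal{S}_A(\bar x\mid\bar\lambda)$. Then the strong variational sufficiency for the problem $\min_{x\in\mathcal{C}} f(x)+g(Ax)$ holds with respect to $(\bar x,\bar\lambda)$.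
   Context: $\delta_{\mathcal{C}}$ is the indicator function of $\mathcal{C}$; $\partial$ is the convex subdifferential (so $\partial\delta_{\mathcal{C}}(x)=N_{\mathcal{C}}(x)$, the normal cone). A polyhedral convex function is a convex function whose epigraph is a polyhedral convex set. $V_{\mathcal{C}}$ is the linear subspace parallel to the affine hull of $\mathcal{C}$, i.e. $V_{\mathcal{C}}=\mathrm{aff}_{\mathcal{C}}-x$ for any $x\in\mathcal{C}$. For $\lambda\in\partial g(y)$, $T_g(y\mid\lambda):=\{w\mid g'(y;w)=\langle\lambda,w\rangle\}$ with $g'(y;w)$ the one-sided directional derivative; $\mathcal{S}(y\mid\lambda):=T_g(y\mid\lambda)-T_g(y\mid\lambda)$ (the set of differences, the smallest subspace containing the cone $T_g(y\mid\lambda)$); and $\mathcal{S}_A(\bar x\mid\bar\lambda):=\{v\in\mathbb{R}^n\mid Av\in\mathcal{S}(A\bar x\mid\bar\lambda)\}$. A symmetric matrix $H$ is positive definite relative to a subspace $V$ if $v^\top Hv>0$ for all $0\ne v\in V$. For $\beta>0$ the Moreau envelope is $M^{1/\beta}_g(w)=\inf_y\{g(y)+\frac{\beta}{2}\|y-w\|^2\}$, and the reduced augmented Lagrangian is $$l_\beta(x,\lambda)=f(x)+M^{1/\beta}_g\bigl(Ax+\tfrac{\lambda}{\beta}\bigr)+\delta_{\mathcal{C}}(x)-\tfrac{1}{2\beta}\|\lambda\|^2.$$ Definition (strong variational sufficiency). Let $(\bar x,\bar\lambda)$ satisfy condition (i). The strong variational sufficiency for the problem $\min_{x\in\mathcal{C}}f(x)+g(Ax)$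 holds with respect to $(\bar x,\bar\lambda)$ if, for every sufficiently large $\beta>0$, there exists a convex neighborhood $\mathcal{X}_\beta\times\Lambda_\beta$ of $(\bar x,\bar\lambda)$ such that $l_\beta(\cdot,\lambda)$ is strongly convex on $\mathcal{X}_\beta$ for every $\lambda\in\Lambda_\beta$, and $l_\beta(x,\cdot)$ is concave on $\Lambda_\beta$ for every $x\in\mathcal{X}_\beta\cap\mathcal{C}$. *)

theory Defs
  imports "HOL-Analysis.Analysis"
begin

text \<open>
  Functions with values in \<open>\<real> \<union> {\<infinity>}\<close> are rendered as \<open>ereal\<close>-valued functions that do not
  attain \<open>-\<infinity>\<close>. Two conventions of \<open>ereal\<close> stay harmless: \<open>0 * \<infinity> = 0\<close>, because convexity
  is tested only with weights strictly between 0 and 1, and \<open>\<infinity> + (-\<infinity>) = \<infinity>\<close>, because the functions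
  involved do not attain \<open>-\<infinity>\<close> (concavity is used only for finite-valued functions).
\<close>

definition ext_dom :: "('a \<Rightarrow> ereal) \<Rightarrow> 'a set"
  where "ext_dom h = {x. h x < \<infinity>}"

definition ext_epigraph :: "('a \<Rightarrow> ereal) \<Rightarrow> ('a \<times> real) set"
  where "ext_epigraph h = {(x, t). h x \<le> ereal t}"

definition ext_convex_on :: "'a::real_vector set \<Rightarrow> ('a \<Rightarrow> ereal) \<Rightarrow> bool"
  where "ext_convex_on S h \<longleftrightarrow> convex S \<and>
    (\<forall>x\<in>S. \<forall>y\<in>S. \<forall>t. 0 < t \<and> t < 1 \<longrightarrow>
      h ((1 - t) *\<^sub>R x + t *\<^sub>R y) \<le> ereal (1 - t) * h x + ereal t * h y)"

definition ext_concave_on :: "'a::real_vector set \<Rightarrow> ('a \<Rightarrow> ereal) \<Rightarrow> bool"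
  where "ext_concave_on S h \<longleftrightarrow> ext_convex_on S (\<lambda>x. - h x)"

definition ext_strongly_convex_on :: "'a::real_normed_vector set \<Rightarrow> ('a \<Rightarrow> ereal) \<Rightarrow> bool"
  where "ext_strongly_convex_on S h \<longleftrightarrow> convex S \<and>
    (\<exists>\<sigma>>0. \<forall>x\<in>S. \<forall>y\<in>S. \<forall>t. 0 < t \<and> t < 1 \<longrightarrow>
      h ((1 - t) *\<^sub>R x + t *\<^sub>R y)
        \<le> ereal (1 - t) * h x + ereal t * h y - ereal (\<sigma> / 2 * t * (1 - t) * (norm (x - y))\<^sup>2))"

definition polyhedral_convex :: "('a::euclidean_space \<Rightarrow> ereal) \<Rightarrow> bool"
  where "polyhedral_convex h \<longleftrightarrow> ext_convex_on UNIV h \<and> polyhedron (ext_epigraph h)"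

text \<open>Convex-analysis indicator: \<open>0\<close> on \<open>C\<close> and \<open>\<infinity>\<close> outside.\<close>

definition delta :: "'a set \<Rightarrow> 'a \<Rightarrow> ereal"
  where "delta C x = (if x \<in> C then 0 else \<infinity>)"

text \<open>Empty outside the effective domain.\<close>

definition subdifferential :: "('a::real_inner \<Rightarrow> ereal) \<Rightarrow> 'a \<Rightarrow> 'a set"
  where "subdifferential h x =
    {v. \<bar>h x\<bar> \<noteq> \<infinity> \<and> (\<forall>y. h x + ereal (v \<bullet> (y - x)) \<le> h y)}"

text \<open>
  The limit exists in \<open>ereal\<close> for every convex \<open>h\<close> and every \<open>y\<close> with \<open>h y\<close> finite,
  the difference quotient then being monotone in \<open>t\<close>.
\<close>

definition dir_deriv :: "('a::real_vector \<Rightarrow> ereal) \<Rightarrow> 'a \<Rightarrow> 'a \<Rightarrow> ereal"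
  where "dir_deriv h y w = Lim (at_right (0::real)) (\<lambda>t. (h (y + t *\<^sub>R w) - h y) / ereal t)"

definition T_cone :: "('a::real_inner \<Rightarrow> ereal) \<Rightarrow> 'a \<Rightarrow> 'a \<Rightarrow> 'a set"
  where "T_cone g y l = {w. dir_deriv g y w = ereal (l \<bullet> w)}"

definition S_space :: "('a::real_inner \<Rightarrow> ereal) \<Rightarrow> 'a \<Rightarrow> 'a \<Rightarrow> 'a set"
  where "S_space g y l = {w1 - w2 | w1 w2. w1 \<in> T_cone g y l \<and> w2 \<in> T_cone g y l}"

definition S_A_space ::
    "(real ^ 'm \<Rightarrow> ereal) \<Rightarrow> real ^ 'n ^ 'm \<Rightarrow> real ^ 'n \<Rightarrow> real ^ 'm \<Rightarrow> (real ^ 'n) set"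
  where "S_A_space g A x l = {v. A *v v \<in> S_space g (A *v x) l}"

definition parallel_space :: "'a::real_vector set \<Rightarrow> 'a set"
  where "parallel_space C = (THE V. subspace V \<and> affine_parallel (affine hull C) V)"

lemma parallel_space_eq:
  assumes "x \<in> C"
  shows "parallel_space C = (\<lambda>y. y - x) ` (affine hull C)"
proof -
  have x: "x \<in> affine hull C"
    using assms by (simp add: hull_inc)
  have *: "subspace ((\<lambda>y. y - x) ` (affine hull C))"
    using affine_diffs_subspace_subtract[OF affine_affine_hull x] .
  have **: "affine_parallel (affine hull C) ((\<lambda>y. y - x) ` (affine hull C))"
    unfolding affine_parallel_def by (rule exI[of _ "- x"]) (simp add: add.commute)
  have "\<exists>!V. subspace V \<and> affine_parallel (affine hull C) V"
    using affine_parallel_subspace[OF affine_affine_hull] x by blast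
  then show ?thesis
    unfolding parallel_space_def using * ** by (intro the1_equality) auto
qed

text \<open>
  \<open>gradient f x\<close> and \<open>hessian f x\<close> are meaningful where \<open>f\<close>, respectively \<open>gradient f\<close>,
  is differentiable at \<open>x\<close>.
\<close>

definition gradient :: "('a::real_inner \<Rightarrow> real) \<Rightarrow> 'a \<Rightarrow> 'a"
  where "gradient f x = (THE D. GDERIV f x :> D)"

definition hessian :: "(real ^ 'n \<Rightarrow> real) \<Rightarrow> real ^ 'n \<Rightarrow> real ^ 'n ^ 'n"
  where "hessian f x = jacobian (gradient f) (at x)"

definition continuously_differentiable :: "('a::real_inner \<Rightarrow> real) \<Rightarrow> bool"
  where "continuously_differentiable f \<longleftrightarrow>
    (\<forall>x. f differentiable (at x)) \<and> continuous_on UNIV (gradient f)"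

definition pos_def_relative :: "real ^ 'n ^ 'n \<Rightarrow> (real ^ 'n) set \<Rightarrow> bool"
  where "pos_def_relative H V \<longleftrightarrow> (\<forall>v\<in>V. v \<noteq> 0 \<longrightarrow> v \<bullet> (H *v v) > 0)"

text \<open>The first argument is the penalty \<open>\<beta>\<close>, so the usual envelope parameter is \<open>1 / \<beta>\<close>.\<close>

definition moreau_envelope ::
    "real \<Rightarrow> ('a::real_normed_vector \<Rightarrow> ereal) \<Rightarrow> 'a \<Rightarrow> ereal"
  where "moreau_envelope \<beta> g w = (INF y. g y + ereal (\<beta> / 2 * (norm (y - w))\<^sup>2))"

definition aug_lagrangian ::
    "(real ^ 'n \<Rightarrow> real) \<Rightarrow> (real ^ 'm \<Rightarrow> ereal) \<Rightarrow> real ^ 'n ^ 'm \<Rightarrow> (real ^ 'n) set \<Rightarrow>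
      real \<Rightarrow> real ^ 'n \<Rightarrow> real ^ 'm \<Rightarrow> ereal"
  where "aug_lagrangian f g A C \<beta> x l =
    ereal (f x) + moreau_envelope \<beta> g (A *v x + (1 / \<beta>) *\<^sub>R l) + delta C x
      - ereal (1 / (2 * \<beta>) * (norm l)\<^sup>2)"

definition first_order_condition ::
    "(real ^ 'n \<Rightarrow> real) \<Rightarrow> (real ^ 'm \<Rightarrow> ereal) \<Rightarrow> real ^ 'n ^ 'm \<Rightarrow> (real ^ 'n) set \<Rightarrow>
      real ^ 'n \<Rightarrow> real ^ 'm \<Rightarrow> bool"
  where "first_order_condition f g A C x l \<longleftrightarrow>
    0 \<in> (\<lambda>v. v + gradient f x + transpose A *v l) ` subdifferential (delta C) x \<and>
    l \<in> subdifferential g (A *v x)"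

text \<open>The first conjunct is the standing assumption under which the notion is defined.\<close>

definition strong_variational_sufficiency ::
    "(real ^ 'n \<Rightarrow> real) \<Rightarrow> (real ^ 'm \<Rightarrow> ereal) \<Rightarrow> real ^ 'n ^ 'm \<Rightarrow> (real ^ 'n) set \<Rightarrow>
      real ^ 'n \<Rightarrow> real ^ 'm \<Rightarrow> bool"
  where "strong_variational_sufficiency f g A C xb lb \<longleftrightarrow>
    first_order_condition f g A C xb lb \<and>
    (\<forall>\<^sub>F \<beta> in at_top. \<exists>X L.
      convex (X \<times> L) \<and> (xb, lb) \<in> interior (X \<times> L) \<and>
      (\<forall>l\<in>L. ext_strongly_convex_on X (\<lambda>x. aug_lagrangian f g A C \<beta> x l)) \<and>
      (\<forall>x\<in>X \<inter> C. ext_concave_on L (\<lambda>l. aug_lagrangian f g A C \<beta> x l)))"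

end

theory Submission
  imports Defs
begin

text \<open>
  The argument replaces the augmented Lagrangian near \<open>(xb, lb)\<close> by an explicit function in which both
  assertions are visible. Put \<open>yb = A *v xb\<close>. Because the epigraph of \<open>g\<close> is a polyhedron, there is a
  compact convex set \<open>Z\<close> containing \<open>0\<close> such that \<open>g\<close> coincides on \<open>yb + Z\<close> with the affine function
  supporting it at \<open>yb\<close> with slope \<open>lb\<close>, and grows away from this function at least linearly in the
  distance to \<open>Z\<close> (\<open>polyhedral_local_growth\<close>, which rests on \<open>polytope_linear_error_bound\<close>). At small
  scale linear growth beats the quadratic proximal term, so the minimization defining the Moreau
  envelope may be restricted to \<open>yb + Z\<close>. For small \<open>d\<close> its value at \<open>yb + lb / \<beta> + d\<close> is therefore
  \<open>const + lb \<bullet> d + \<beta> / 2 * (infdist d Z)\<^sup>2\<close> (\<open>moreau_envelope_near_multiplier\<close>), where in the augmented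
  Lagrangian \<open>d = A *v (x - xb) + (l - lb) / \<beta>\<close> is affine in \<open>x\<close> and in \<open>l\<close>.

  Concavity in \<open>l\<close>: a squared distance is \<open>(norm d)\<^sup>2\<close> plus a concave function, and the term
  \<open>- (norm l)\<^sup>2 / (2 * \<beta>)\<close> exactly cancels the convex part (\<open>infdist_square_semiconcave\<close>).

  Strong convexity in \<open>x\<close>: a squared distance to \<open>Z\<close> is as convex as the squared distance to \<open>span Z\<close>
  (\<open>infdist_square_strongly_convex_modulo_span\<close>). Along \<open>v = x - y\<close> with \<open>x, y \<in> C\<close> the curvature of the
  augmented Lagrangian is thus at least, up to an error that is small near \<open>xb\<close>,
  \<open>v \<bullet> (H *v v) + \<beta> * (infdist (A *v v) (span Z))\<^sup>2\<close>, where \<open>H\<close> is the Hessian of \<open>f\<close> at \<open>xb\<close>. All such \<open>v\<close>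
  lie in the subspace parallel to \<open>C\<close>, and \<open>span Z\<close> is contained in \<open>S_space g yb lb\<close>
  (\<open>span_critical_set_subset_S_space\<close>). By the second-order condition \<open>H\<close> is therefore positive on those
  \<open>v \<noteq> 0\<close> with \<open>A *v v \<in> span Z\<close>, and \<open>finsler_penalization\<close> bounds the curvature from below by a positive
  multiple of \<open>(norm v)\<^sup>2\<close> once \<open>\<beta>\<close> is large.
\<close>

section \<open>Squared distance to a convex set\<close>

lemma norm_square_convex_combination:
  fixes x y :: "'a::real_inner"
  shows "(norm ((1 - t) *\<^sub>R x + t *\<^sub>R y))\<^sup>2
    = (1 - t) * (norm x)\<^sup>2 + t * (norm y)\<^sup>2 - t * (1 - t) * (norm (x - y))\<^sup>2"
  unfolding power2_norm_eq_inner
  by (simp add: inner_add_left inner_add_right inner_diff_left inner_diff_right inner_commute[of y x] algebra_simps)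

text \<open>
  For a subspace \<open>Z\<close> this would be the strong convexity of the squared length of the component
  orthogonal to \<open>Z\<close>. The point is that nothing more than \<open>span Z\<close> is lost for a general convex set.
\<close>

lemma infdist_square_strongly_convex_modulo_span:
  fixes Z :: "'a::euclidean_space set"
  assumes Z: "convex Z" "closed Z" "Z \<noteq> {}" and t: "0 \<le> t" "t \<le> 1"
  shows "(infdist ((1 - t) *\<^sub>R x + t *\<^sub>R y) Z)\<^sup>2
    \<le> (1 - t) * (infdist x Z)\<^sup>2 + t * (infdist y Z)\<^sup>2
      - t * (1 - t) * (infdist (x - y) (span Z))\<^sup>2"
proof -
  obtain a where a: "a \<in> Z" "infdist x Z = dist x a"
    using infdist_attains_inf[OF Z(2,3)] by blast
  obtain b where b: "b \<in> Z" "infdist y Z = dist y b"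
    using infdist_attains_inf[OF Z(2,3)] by blast
  \<comment> \<open>The convex combination of the two projections competes at the intermediate point. The loss
    term left by the parallelogram identity involves \<open>(x - y) - (a - b)\<close> with \<open>a - b \<in> span Z\<close>.\<close>
  let ?c = "(1 - t) *\<^sub>R a + t *\<^sub>R b"
  have "?c \<in> Z"
    using Z(1) a(1) b(1) t by (simp add: convex_alt)
  then have "infdist ((1 - t) *\<^sub>R x + t *\<^sub>R y) Z \<le> norm ((1 - t) *\<^sub>R x + t *\<^sub>R y - ?c)"
    using infdist_le[of ?c Z] by (simp add: dist_norm)
  also have "(1 - t) *\<^sub>R x + t *\<^sub>R y - ?c = (1 - t) *\<^sub>R (x - a) + t *\<^sub>R (y - b)"
    by (simp add: algebra_simps)
  finally have "(infdist ((1 - t) *\<^sub>R x + t *\<^sub>R y) Z)\<^sup>2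
      \<le> (norm ((1 - t) *\<^sub>R (x - a) + t *\<^sub>R (y - b)))\<^sup>2"
    by (intro power_mono infdist_nonneg)
  also have "\<dots> = (1 - t) * (infdist x Z)\<^sup>2 + t * (infdist y Z)\<^sup>2
      - t * (1 - t) * (norm ((x - a) - (y - b)))\<^sup>2"
    by (simp add: norm_square_convex_combination a b dist_norm)
  also have "\<dots> \<le> (1 - t) * (infdist x Z)\<^sup>2 + t * (infdist y Z)\<^sup>2
      - t * (1 - t) * (infdist (x - y) (span Z))\<^sup>2"
  proof -
    have "a - b \<in> span Z"
      using a b by (simp add: span_base span_diff)
    then have "infdist (x - y) (span Z) \<le> norm ((x - a) - (y - b))"
      using infdist_le[of "a - b" "span Z" "x - y"] by (simp add: dist_norm algebra_simps)
    then have "(infdist (x - y) (span Z))\<^sup>2 \<le> (norm ((x - a) - (y - b)))\<^sup>2"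
      by (intro power_mono infdist_nonneg)
    then show ?thesis
      using t by (simp add: mult_left_mono)
  qed
  finally show ?thesis .
qed

text \<open>
  The squared distance is an infimum of the functions \<open>x \<mapsto> (norm (x - c))\<^sup>2\<close>, which differ from
  \<open>(norm x)\<^sup>2\<close> by affine functions.
\<close>

lemma infdist_square_semiconcave:
  fixes Z :: "'a::euclidean_space set"
  assumes Z: "closed Z" "Z \<noteq> {}" and t: "0 \<le> t" "t \<le> 1"
  shows "(1 - t) * (infdist x Z)\<^sup>2 + t * (infdist y Z)\<^sup>2 - t * (1 - t) * (norm (x - y))\<^sup>2
    \<le> (infdist ((1 - t) *\<^sub>R x + t *\<^sub>R y) Z)\<^sup>2"
proof -
  obtain c where c: "c \<in> Z" "infdist ((1 - t) *\<^sub>R x + t *\<^sub>R y) Z = dist ((1 - t) *\<^sub>R x + t *\<^sub>R y) c"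
    using infdist_attains_inf[OF Z] by blast
  have eq: "(1 - t) *\<^sub>R x + t *\<^sub>R y - c = (1 - t) *\<^sub>R (x - c) + t *\<^sub>R (y - c)"
    by (simp add: algebra_simps)
  have "(infdist ((1 - t) *\<^sub>R x + t *\<^sub>R y) Z)\<^sup>2
      = (1 - t) * (norm (x - c))\<^sup>2 + t * (norm (y - c))\<^sup>2 - t * (1 - t) * (norm (x - y))\<^sup>2"
    unfolding c(2) dist_norm eq by (simp add: norm_square_convex_combination)
  moreover have "(infdist x Z)\<^sup>2 \<le> (norm (x - c))\<^sup>2" "(infdist y Z)\<^sup>2 \<le> (norm (y - c))\<^sup>2"
    using infdist_le[OF c(1)] by (auto simp: dist_norm intro!: power_mono infdist_nonneg)
  ultimately show ?thesis
    using t by (simp add: add_mono mult_left_mono)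
qed

lemma infdist_subspace_scaleR_le:
  fixes S :: "'a::euclidean_space set"
  assumes "subspace S"
  shows "infdist (c *\<^sub>R x) S \<le> \<bar>c\<bar> * infdist x S"
proof -
  obtain s where s: "s \<in> S" "infdist x S = dist x s"
    using infdist_attains_inf[OF closed_subspace[OF assms]] subspace_0[OF assms] by blast
  have "c *\<^sub>R s \<in> S"
    using assms s(1) by (simp add: subspace_scale)
  from infdist_le[OF this, of "c *\<^sub>R x"] show ?thesis
    by (simp add: s dist_norm flip: scaleR_diff_right)
qed

section \<open>Linear growth of polyhedral functions\<close>

text \<open>
  An error bound of Hoffman type: the distance to an exposed face grows at most linearly in the
  height above the supporting hyperplane. A polytope has finitely many vertices, and those off the
  face have a smallest positive height; this is where polyhedrality enters.
\<close>

lemma polytope_linear_error_bound: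
  fixes E :: "'a::euclidean_space set"
  assumes E: "polytope E" and lower: "\<And>e. e \<in> E \<Longrightarrow> b \<le> n \<bullet> e"
    and e0: "e0 \<in> E" "n \<bullet> e0 = b"
  obtains K where "0 \<le> K" "\<And>e. e \<in> E \<Longrightarrow> \<exists>z\<in>E \<inter> {z. n \<bullet> z = b}. norm (e - z) \<le> K * (n \<bullet> e - b)"
proof -
  obtain V where V: "finite V" "E = convex hull V"
    using E by (auto simp: polytope_def)
  define K where "K = (\<Sum>v\<in>V. norm (v - e0) / (n \<bullet> v - b))"
  have pos: "0 \<le> n \<bullet> v - b" if "v \<in> V" for v
    using lower[of v] that V(2) by (simp add: hull_inc)
  have K0: "0 \<le> K"
    unfolding K_def by (intro sum_nonneg divide_nonneg_nonneg pos norm_ge_zero)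
  let ?F = "E \<inter> {z. n \<bullet> z = b}"
  let ?G = "{e. \<exists>z\<in>?F. norm (e - z) \<le> K * (n \<bullet> e - b)}"
  have F: "convex ?F"
    using polytope_imp_convex[OF E] convex_hyperplane convex_Int by blast
  \<comment> \<open>The estimate is a convex condition on \<open>e\<close>, so the vertices decide. A vertex on the face is its
    own witness; \<open>K\<close> is large enough for \<open>e0\<close> to be the witness of every other vertex, and the
    vertices on the face contribute nothing to \<open>K\<close>, by division by zero.\<close>
  have "convex ?G"
    unfolding convex_alt
  proof (intro ballI allI impI, elim conjE)
    fix x y and u :: real
    assume "x \<in> ?G" "y \<in> ?G" and u: "0 \<le> u" "u \<le> 1"
    then obtain p q where pq: "p \<in> ?F" "norm (x - p) \<le> K * (n \<bullet> x - b)"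
      "q \<in> ?F" "norm (y - q) \<le> K * (n \<bullet> y - b)" by blast
    let ?r = "(1 - u) *\<^sub>R p + u *\<^sub>R q"
    have r: "?r \<in> ?F"
      using F pq u unfolding convex_alt by blast
    have "(1 - u) *\<^sub>R x + u *\<^sub>R y - ?r = (1 - u) *\<^sub>R (x - p) + u *\<^sub>R (y - q)"
      by (simp add: algebra_simps)
    then have "norm ((1 - u) *\<^sub>R x + u *\<^sub>R y - ?r) \<le> (1 - u) * norm (x - p) + u * norm (y - q)"
      using u norm_triangle_ineq[of "(1 - u) *\<^sub>R (x - p)" "u *\<^sub>R (y - q)"] by simp
    also have "\<dots> \<le> (1 - u) * (K * (n \<bullet> x - b)) + u * (K * (n \<bullet> y - b))"
      using u pq by (intro add_mono mult_left_mono) auto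
    also have "\<dots> = K * (n \<bullet> ((1 - u) *\<^sub>R x + u *\<^sub>R y) - b)"
      by (simp add: algebra_simps)
    finally show "(1 - u) *\<^sub>R x + u *\<^sub>R y \<in> ?G"
      using r by blast
  qed
  moreover have "V \<subseteq> ?G"
  proof
    fix v assume v: "v \<in> V"
    then have vE: "v \<in> E" by (simp add: V(2) hull_inc)
    show "v \<in> ?G"
    proof (cases "n \<bullet> v = b")
      case True
      then have "v \<in> ?F" using vE by simp
      then show ?thesis using True by force
    next
      case False
      then have p: "0 < n \<bullet> v - b" using pos[OF v] by simp
      have "norm (v - e0) / (n \<bullet> v - b) \<le> K"
        unfolding K_def using v V(1) pos
        by (intro member_le_sum) (auto intro!: divide_nonneg_nonneg)
      then have "norm (v - e0) \<le> K * (n \<bullet> v - b)"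
        using p by (simp add: divide_le_eq)
      moreover have "e0 \<in> ?F" using e0 by simp
      ultimately show ?thesis by blast
    qed
  qed
  ultimately have "E \<subseteq> ?G"
    unfolding V(2) by (intro hull_minimal)
  then show ?thesis using that K0 by blast
qed

text \<open>
  Cutting the epigraph with a box around the base point gives a polytope whose lowest face, seen from
  the supporting affine function, projects onto a set \<open>Z\<close> of displacements along which \<open>g\<close> is affine
  with slope \<open>l\<close>. The error bound for that face says that \<open>g\<close> leaves its supporting affine function at
  least linearly in the distance to \<open>Z\<close>.
\<close>

lemma polyhedral_local_growth:
  fixes g :: "'a::euclidean_space \<Rightarrow> ereal"
  assumes poly: "polyhedron (ext_epigraph g)" and yb: "g yb = ereal g0"
    and sub: "l \<in> subdifferential g yb"
  obtains Z K r where "compact Z" "convex Z" "0 \<in> Z" "0 \<le> K" "0 < r"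
    "\<And>z. z \<in> Z \<Longrightarrow> g (yb + z) = ereal (g0 + l \<bullet> z)"
    "\<And>u t. norm u \<le> r \<Longrightarrow> t \<le> r \<Longrightarrow> g (yb + u) = ereal (g0 + l \<bullet> u + t) \<Longrightarrow> infdist u Z \<le> K * t"
proof -
  have subg: "ereal (g0 + l \<bullet> (y - yb)) \<le> g y" for y
    using sub yb by (simp add: subdifferential_def)
  let ?z = "(yb, g0)"
  define E where "E = cbox (?z - One) (?z + One) \<inter> ext_epigraph g"
  \<comment> \<open>With these \<open>n\<close> and \<open>b\<close>, the number \<open>n \<bullet> (y, s) - b\<close> is the height of \<open>(y, s)\<close> above the
    supporting affine function given by the subgradient.\<close>
  define n where "n = (- l, 1::real)"
  define b where "b = g0 - l \<bullet> yb"
  have E: "polytope E"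
    using poly unfolding E_def by (intro polytope_Int_polyhedron polytope_interval)
  have height: "n \<bullet> (y, s) - b = s - g0 - l \<bullet> (y - yb)" for y s
    by (simp add: n_def b_def inner_diff_right)
  have lower: "b \<le> n \<bullet> e" if "e \<in> E" for e
  proof -
    obtain y s where e: "e = (y, s)" by (cases e)
    have "g y \<le> ereal s" using that by (simp add: e E_def ext_epigraph_def)
    with subg[of y] have "ereal (g0 + l \<bullet> (y - yb)) \<le> ereal s" by (rule order_trans)
    then show ?thesis using height[of y s] by (simp add: e)
  qed
  have zbox: "?z \<in> box (?z - One) (?z + One)"
    unfolding mem_box inner_diff_left inner_add_left by (simp add: inner_sum_left inner_Basis if_distrib cong: if_cong)
  have e0: "?z \<in> E" "n \<bullet> ?z = b"
    using zbox box_subset_cbox yb height[of yb g0] by (auto simp: E_def ext_epigraph_def)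
  obtain K where K: "0 \<le> K" "\<And>e. e \<in> E \<Longrightarrow> \<exists>z\<in>E \<inter> {z. n \<bullet> z = b}. norm (e - z) \<le> K * (n \<bullet> e - b)"
    using polytope_linear_error_bound[OF E lower e0] by blast
  define F where "F = E \<inter> {z. n \<bullet> z = b}"
  have F: "compact F" "convex F"
    unfolding F_def using polytope_imp_compact[OF E] polytope_imp_convex[OF E]
    by (simp_all add: compact_Int_closed closed_hyperplane convex_Int convex_hyperplane)
  define Z where "Z = (\<lambda>e. fst e - yb) ` F"
  obtain q where q: "0 < q" "ball ?z q \<subseteq> box (?z - One) (?z + One)"
    using zbox open_box open_contains_ball by blast
  define r where "r = q / (2 * (norm l + 2))"
  have r: "0 < r" "r * (norm l + 2) < q"
  proof -
    have pos: "0 < norm l + 2" by (simp add: add_nonneg_pos)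
    then show "0 < r" using q(1) by (simp add: r_def)
    have "r * (norm l + 2) = q / 2" using pos by (simp add: r_def divide_simps)
    then show "r * (norm l + 2) < q" using q(1) by simp
  qed
  show ?thesis
  proof (rule that[of Z K r])
    show "compact Z"
      unfolding Z_def by (intro compact_continuous_image continuous_intros F)
    have "Z = (\<lambda>y. - yb + y) ` fst ` F"
      unfolding Z_def image_image by simp
    then show "convex Z"
      using F(2) by (simp only: convex_translation convex_linear_image linear_fst)
    show "0 \<in> Z"
      unfolding Z_def F_def using e0 by force
    show "g (yb + z) = ereal (g0 + l \<bullet> z)" if zZ: "z \<in> Z" for z
    proof -
      obtain e where "e \<in> F" "z = fst e - yb"
        using zZ unfolding Z_def by blast
      then obtain y s where ys: "(y, s) \<in> F" "z = y - yb"
        by (cases e) simp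
      then have "s = g0 + l \<bullet> z" "g y \<le> ereal s"
        using height[of y s] by (auto simp: F_def E_def ext_epigraph_def)
      with subg[of y] show ?thesis by (simp add: ys(2))
    qed
    fix u t assume ut: "norm u \<le> r" "t \<le> r" "g (yb + u) = ereal (g0 + l \<bullet> u + t)"
    have t: "0 \<le> t" using subg[of "yb + u"] ut(3) by simp
    let ?e = "(yb + u, g0 + (l \<bullet> u + t))"
    have "dist ?z ?e = norm (?e - ?z)" by (metis dist_norm norm_minus_commute)
    also have "\<dots> = norm (u, l \<bullet> u + t)" by simp
    also have "\<dots> \<le> norm u + norm (l \<bullet> u + t)" by (rule norm_Pair_le)
    also have "\<dots> \<le> r + (norm l * r + r)"
    proof -
      have "\<bar>l \<bullet> u\<bar> \<le> norm l * norm u" by (rule Cauchy_Schwarz_ineq2)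
      also have "\<dots> \<le> norm l * r" using ut by (intro mult_left_mono) auto
      finally show ?thesis using ut t by simp
    qed
    also have "\<dots> < q" using r by (simp add: algebra_simps)
    finally have "?e \<in> E"
      using q(2) box_subset_cbox ut(3) by (force simp: E_def ext_epigraph_def add.assoc)
    then obtain e where e: "e \<in> F" "norm (?e - e) \<le> K * (n \<bullet> ?e - b)"
      using K(2) unfolding F_def by blast
    have "infdist u Z \<le> dist u (fst e - yb)"
      using e(1) by (intro infdist_le) (auto simp: Z_def)
    also have "\<dots> = norm (fst (?e - e))" by (simp add: dist_norm algebra_simps)
    also have "\<dots> \<le> norm (?e - e)" by (metis norm_fst_le prod.collapse)
    also have "\<dots> \<le> K * t" using e(2) height[of "yb + u" "g0 + (l \<bullet> u + t)"] by simp
    finally show "infdist u Z \<le> K * t" .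
  qed (use K r in auto)
qed

section \<open>The Moreau envelope near the multiplier\<close>

text \<open>
  Linear growth dominates a quadratic at small scale. Hence close to \<open>yb + l / \<beta>\<close> the growth of \<open>g\<close>
  acts as an exact penalty for the constraint \<open>u \<in> Z\<close> on the displacement \<open>u\<close>, and the proximal problem
  becomes the projection of \<open>d\<close> onto \<open>Z\<close>.
\<close>

lemma moreau_envelope_near_multiplier:
  fixes g :: "'a::euclidean_space \<Rightarrow> ereal"
  assumes yb: "g yb = ereal g0" and sub: "l \<in> subdifferential g yb"
    and Z: "closed Z" "0 \<in> Z" and K: "0 \<le> K" and r: "0 < r"
    and gZ: "\<And>z. z \<in> Z \<Longrightarrow> g (yb + z) = ereal (g0 + l \<bullet> z)"
    and growth: "\<And>u t. norm u \<le> r \<Longrightarrow> t \<le> r \<Longrightarrow> g (yb + u) = ereal (g0 + l \<bullet> u + t)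
      \<Longrightarrow> infdist u Z \<le> K * t"
    and \<beta>: "0 < \<beta>" and d: "norm d \<le> r / 2" "\<beta> / 2 * (norm d)\<^sup>2 \<le> r" "\<beta> * K * norm d \<le> 1"
  shows "moreau_envelope \<beta> g (yb + (1 / \<beta>) *\<^sub>R l + d)
    = ereal (g0 + l \<bullet> d + (norm l)\<^sup>2 / (2 * \<beta>) + \<beta> / 2 * (infdist d Z)\<^sup>2)"
proof -
  have subg: "ereal (g0 + l \<bullet> (y - yb)) \<le> g y" for y
    using sub yb by (simp add: subdifferential_def)
  \<comment> \<open>Completing the square turns the linear term of \<open>g\<close> and the shift \<open>l / \<beta>\<close> of the argument into
    constants.\<close>
  have square: "l \<bullet> u + \<beta> / 2 * (norm (yb + u - (yb + (1 / \<beta>) *\<^sub>R l + d)))\<^sup>2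
      = l \<bullet> d + (norm l)\<^sup>2 / (2 * \<beta>) + \<beta> / 2 * (norm (u - d))\<^sup>2" for u
  proof -
    have "yb + u - (yb + (1 / \<beta>) *\<^sub>R l + d) = (u - d) - (1 / \<beta>) *\<^sub>R l" by simp
    then have "(norm (yb + u - (yb + (1 / \<beta>) *\<^sub>R l + d)))\<^sup>2
        = (norm (u - d))\<^sup>2 - 2 / \<beta> * (l \<bullet> (u - d)) + (norm l)\<^sup>2 / \<beta>\<^sup>2"
      unfolding power2_norm_eq_inner
      by (simp only: inner_diff_left inner_diff_right inner_scaleR_left inner_scaleR_right)
        (simp add: inner_commute power2_eq_square algebra_simps)
    then show ?thesis
      using \<beta> by (simp add: inner_diff_right power2_eq_square field_simps)
  qed
  let ?c = "g0 + l \<bullet> d + (norm l)\<^sup>2 / (2 * \<beta>)"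
  \<comment> \<open>Here \<open>t\<close> is the height of \<open>g\<close> above its supporting affine function. Points with a large
    displacement or a large height lose against \<open>u = 0\<close>; for the others \<open>t\<close> pays for moving \<open>u\<close>
    into \<open>Z\<close>.\<close>
  have below: "\<beta> / 2 * (infdist d Z)\<^sup>2 \<le> t + \<beta> / 2 * (norm (u - d))\<^sup>2"
    if t: "0 \<le> t" and gu: "g (yb + u) = ereal (g0 + l \<bullet> u + t)" for u t
  proof -
    define \<delta> where "\<delta> = infdist d Z"
    have \<delta>: "0 \<le> \<delta>" "\<delta> \<le> norm d"
      using infdist_le[OF Z(2), of d] by (auto simp: \<delta>_def infdist_nonneg)
    consider "norm u > r" | "t > r" | "norm u \<le> r" "t \<le> r" by linarith
    then have "\<beta> / 2 * \<delta>\<^sup>2 \<le> t + \<beta> / 2 * (norm (u - d))\<^sup>2"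
    proof cases
      case 1
      then have "\<delta> \<le> norm (u - d)"
        using \<delta>(2) d(1) norm_triangle_sub[of u d] by linarith
      then have "\<delta>\<^sup>2 \<le> (norm (u - d))\<^sup>2" using \<delta>(1) by (intro power_mono)
      then have "\<beta> / 2 * \<delta>\<^sup>2 \<le> \<beta> / 2 * (norm (u - d))\<^sup>2" using \<beta> by (intro mult_left_mono) auto
      then show ?thesis using t by linarith
    next
      case 2
      have "\<delta>\<^sup>2 \<le> (norm d)\<^sup>2" using \<delta> by (intro power_mono)
      then have "\<beta> / 2 * \<delta>\<^sup>2 \<le> \<beta> / 2 * (norm d)\<^sup>2" using \<beta> by (intro mult_left_mono) auto
      moreover have "0 \<le> \<beta> / 2 * (norm (u - d))\<^sup>2" using \<beta> by simp
      ultimately show ?thesis using 2 d(2) by linarith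
    next
      case 3
      let ?e = "norm (u - d)"
      have tri: "\<delta> - ?e \<le> K * t"
        using infdist_triangle[of d Z u] growth[OF 3 gu]
        by (simp add: \<delta>_def dist_norm norm_minus_commute)
      show ?thesis
      proof (cases "\<delta> \<le> ?e")
        case True
        then have "\<delta>\<^sup>2 \<le> ?e\<^sup>2" using \<delta>(1) by (intro power_mono)
        then have "\<beta> / 2 * \<delta>\<^sup>2 \<le> \<beta> / 2 * ?e\<^sup>2" using \<beta> by (intro mult_left_mono) auto
        then show ?thesis using t by linarith
      next
        case False
        have "\<delta>\<^sup>2 - ?e\<^sup>2 = (\<delta> - ?e) * (\<delta> + ?e)"
          by (simp add: power2_eq_square algebra_simps)
        also have "\<dots> \<le> (K * t) * (2 * \<delta>)"
          using False tri \<delta>(1) K t by (intro mult_mono) auto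
        finally have "\<beta> / 2 * (\<delta>\<^sup>2 - ?e\<^sup>2) \<le> \<beta> / 2 * ((K * t) * (2 * \<delta>))"
          using \<beta> by (intro mult_left_mono) auto
        also have "\<dots> = (\<beta> * K * \<delta>) * t" by simp
        also have "\<dots> \<le> 1 * t"
        proof (intro mult_right_mono t)
          have "\<beta> * K * \<delta> \<le> \<beta> * K * norm d" using \<beta> K \<delta> by (intro mult_left_mono) auto
          then show "\<beta> * K * \<delta> \<le> 1" using d(3) by linarith
        qed
        finally show ?thesis by (simp add: algebra_simps)
      qed
    qed
    then show ?thesis by (simp add: \<delta>_def)
  qed
  show ?thesis
    unfolding moreau_envelope_def
  proof (rule antisym)
    obtain z where z: "z \<in> Z" "infdist d Z = dist d z"
      using infdist_attains_inf[of Z d] Z by blast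
    show "(INF y. g y + ereal (\<beta> / 2 * (norm (y - (yb + (1 / \<beta>) *\<^sub>R l + d)))\<^sup>2))
        \<le> ereal (?c + \<beta> / 2 * (infdist d Z)\<^sup>2)"
      using gZ[OF z(1)] square[of z]
      by (intro INF_lower2[of "yb + z"]) (auto simp: z(2) dist_norm norm_minus_commute)
    show "ereal (?c + \<beta> / 2 * (infdist d Z)\<^sup>2)
        \<le> (INF y. g y + ereal (\<beta> / 2 * (norm (y - (yb + (1 / \<beta>) *\<^sub>R l + d)))\<^sup>2))"
    proof (rule INF_greatest)
      fix y
      show "ereal (?c + \<beta> / 2 * (infdist d Z)\<^sup>2)
          \<le> g y + ereal (\<beta> / 2 * (norm (y - (yb + (1 / \<beta>) *\<^sub>R l + d)))\<^sup>2)"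
      proof (cases "g y")
        case (real s)
        define u where "u = y - yb"
        define t where "t = s - g0 - l \<bullet> u"
        have y: "y = yb + u" and s: "s = g0 + l \<bullet> u + t" by (simp_all add: u_def t_def)
        have "0 \<le> t" using subg[of y] real by (simp add: t_def u_def)
        moreover have "g (yb + u) = ereal (g0 + l \<bullet> u + t)" using real y s by simp
        ultimately have "\<beta> / 2 * (infdist d Z)\<^sup>2 \<le> t + \<beta> / 2 * (norm (u - d))\<^sup>2" by (rule below)
        then show ?thesis using square[of u] real unfolding y s by simp
      next
        case MInf
        then show ?thesis using subg[of y] by simp
      qed auto
    qed
  qed
qed

text \<open>
  The smallness conditions on a displacement of norm \<open>s\<close> under which the envelope is a squared distance:
  it stays inside the region of linear growth, and the quadratic term is dominated there.
\<close>

lemma small_radius_for_envelope: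
  fixes \<beta> K r :: real
  assumes "0 < \<beta>" "0 \<le> K" "0 < r"
  obtains \<eta> where "0 < \<eta>"
    "\<And>s. 0 \<le> s \<Longrightarrow> s \<le> \<eta> \<Longrightarrow> s \<le> r / 2 \<and> \<beta> / 2 * s\<^sup>2 \<le> r \<and> \<beta> * K * s \<le> 1"
proof (rule that[of "Min {r / 2, 1, 2 * r / \<beta>, 1 / (\<beta> * K + 1)}"])
  have bk: "0 < \<beta> * K + 1" using assms by (simp add: add_nonneg_pos)
  then show "0 < Min {r / 2, 1, 2 * r / \<beta>, 1 / (\<beta> * K + 1)}" using assms by simp
  fix s :: real assume s: "0 \<le> s" "s \<le> Min {r / 2, 1, 2 * r / \<beta>, 1 / (\<beta> * K + 1)}"
  then have le: "s \<le> r / 2" "s \<le> 1" "s \<le> 2 * r / \<beta>" "s \<le> 1 / (\<beta> * K + 1)" by auto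
  have "s\<^sup>2 \<le> s" using s(1) le(2) by (simp add: power2_eq_square mult_left_le)
  then have "\<beta> / 2 * s\<^sup>2 \<le> \<beta> / 2 * (2 * r / \<beta>)"
    using le(3) assms by (intro mult_left_mono) auto
  then have "\<beta> / 2 * s\<^sup>2 \<le> r" using assms by simp
  moreover have "s * (\<beta> * K + 1) \<le> 1" using le(4) bk by (simp add: pos_le_divide_eq)
  then have "\<beta> * K * s \<le> 1" using s(1) by (simp add: algebra_simps)
  ultimately show "s \<le> r / 2 \<and> \<beta> / 2 * s\<^sup>2 \<le> r \<and> \<beta> * K * s \<le> 1" using le(1) by blast
qed

section \<open>Critical directions\<close>

text \<open>
  Along the ray through \<open>z\<close> the difference quotient is eventually constant.
\<close>

lemma scaled_critical_direction_in_T_cone: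
  fixes g :: "'a::real_inner \<Rightarrow> ereal"
  assumes Z: "convex Z" "0 \<in> Z" and yb: "g yb = ereal g0"
    and gZ: "\<And>z. z \<in> Z \<Longrightarrow> g (yb + z) = ereal (g0 + l \<bullet> z)"
    and a: "0 \<le> a" and z: "z \<in> Z"
  shows "a *\<^sub>R z \<in> T_cone g yb l"
proof -
  have "\<forall>\<^sub>F t in at_right 0. (g (yb + t *\<^sub>R (a *\<^sub>R z)) - g yb) / ereal t = ereal (l \<bullet> (a *\<^sub>R z))"
    unfolding eventually_at_right_field
  proof (intro exI[of _ "1 / (a + 1)"] conjI allI impI)
    show "0 < 1 / (a + 1)" using a by simp
    fix t :: real assume t: "0 < t" "t < 1 / (a + 1)"
    then have "t * (a + 1) < 1" using a by (simp add: field_simps)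
    then have ta: "0 \<le> t * a" "t * a \<le> 1" using t a by (auto simp: algebra_simps)
    have "(1 - t * a) *\<^sub>R 0 + (t * a) *\<^sub>R z \<in> Z"
      using Z z ta unfolding convex_alt by blast
    then have "g (yb + t *\<^sub>R (a *\<^sub>R z)) = ereal (g0 + l \<bullet> ((t * a) *\<^sub>R z))"
      using gZ by simp
    then show "(g (yb + t *\<^sub>R (a *\<^sub>R z)) - g yb) / ereal t = ereal (l \<bullet> (a *\<^sub>R z))"
      using t yb by simp
  qed
  then have "((\<lambda>t. (g (yb + t *\<^sub>R (a *\<^sub>R z)) - g yb) / ereal t) \<longlongrightarrow> ereal (l \<bullet> (a *\<^sub>R z))) (at_right 0)"
    by (rule tendsto_eventually)
  then show ?thesis
    unfolding T_cone_def dir_deriv_def by (simp add: tendsto_Lim)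
qed

text \<open>
  Multiples of elements of a convex set already form a convex cone, and the differences of a convex
  cone form a subspace.
\<close>

lemma span_convex_subset_cone_differences:
  fixes Z :: "'a::real_vector set"
  assumes Z: "convex Z" "0 \<in> Z"
  shows "span Z \<subseteq> {a *\<^sub>R x - b *\<^sub>R y | a b x y. 0 \<le> a \<and> 0 \<le> b \<and> x \<in> Z \<and> y \<in> Z}"
proof -
  let ?T = "cone hull Z"
  let ?D = "{p - q | p q. p \<in> ?T \<and> q \<in> ?T}"
  have "cone ?T" by (rule cone_cone_hull)
  with convex_cone_hull[OF Z(1)]
  have T: "p + q \<in> ?T" "0 \<le> c \<Longrightarrow> c *\<^sub>R p \<in> ?T" if "p \<in> ?T" "q \<in> ?T" for p q c
    using convex_cone[of ?T] that by blast+
  have T0: "0 \<in> ?T" using Z(2) by (simp add: hull_inc)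
  have "subspace ?D"
    unfolding subspace_def
  proof (intro conjI ballI allI)
    show "0 \<in> ?D" using T0 by force
    show "x + y \<in> ?D" if xy: "x \<in> ?D" "y \<in> ?D" for x y
    proof -
      obtain p q p' q' where "x = p - q" "y = p' - q'" "p \<in> ?T" "q \<in> ?T" "p' \<in> ?T" "q' \<in> ?T"
        using xy by blast
      moreover from this have "x + y = (p + p') - (q + q')" by simp
      ultimately show ?thesis using T(1) by blast
    qed
    show "c *\<^sub>R x \<in> ?D" if x: "x \<in> ?D" for c x
    proof -
      obtain p q where pq: "x = p - q" "p \<in> ?T" "q \<in> ?T" using x by blast
      show ?thesis
      proof (cases "0 \<le> c")
        case True
        then have "c *\<^sub>R p \<in> ?T" "c *\<^sub>R q \<in> ?T" using T(2) pq by auto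
        moreover have "c *\<^sub>R x = c *\<^sub>R p - c *\<^sub>R q" by (simp add: pq algebra_simps)
        ultimately show ?thesis by blast
      next
        case False
        then have "(- c) *\<^sub>R p \<in> ?T" "(- c) *\<^sub>R q \<in> ?T" using T(2)[of p p "-c"] T(2)[of q q "-c"] pq by auto
        moreover have "c *\<^sub>R x = (- c) *\<^sub>R q - (- c) *\<^sub>R p" by (simp add: pq algebra_simps)
        ultimately show ?thesis by blast
      qed
    qed
  qed
  moreover have "Z \<subseteq> ?D"
  proof
    fix z assume "z \<in> Z"
    then have "z \<in> ?T" "z = z - 0" by (simp_all add: hull_inc)
    then show "z \<in> ?D" using T0 by blast
  qed
  ultimately have "span Z \<subseteq> ?D" by (intro span_minimal)
  then show ?thesis unfolding cone_hull_expl by blast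
qed

lemma span_critical_set_subset_S_space:
  fixes g :: "'a::real_inner \<Rightarrow> ereal"
  assumes Z: "convex Z" "0 \<in> Z" and yb: "g yb = ereal g0"
    and gZ: "\<And>z. z \<in> Z \<Longrightarrow> g (yb + z) = ereal (g0 + l \<bullet> z)"
  shows "span Z \<subseteq> S_space g yb l"
proof
  fix v assume "v \<in> span Z"
  then obtain a b x y where v: "v = a *\<^sub>R x - b *\<^sub>R y" "0 \<le> a" "0 \<le> b" "x \<in> Z" "y \<in> Z"
    using span_convex_subset_cone_differences[OF Z] by blast
  have "a *\<^sub>R x \<in> T_cone g yb l" "b *\<^sub>R y \<in> T_cone g yb l"
    using scaled_critical_direction_in_T_cone[OF Z yb gZ] v by auto
  then show "v \<in> S_space g yb l"
    unfolding S_space_def v(1) by blast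
qed

section \<open>Second-order lower bounds for smooth functions\<close>

text \<open>
  The gradient vector is the adjoint of the derivative applied to \<open>1\<close>.
\<close>

lemma GDERIV_gradient:
  fixes f :: "'a::euclidean_space \<Rightarrow> real"
  assumes "f differentiable (at x)"
  shows "GDERIV f x :> gradient f x"
proof -
  obtain f' where f': "(f has_derivative f') (at x)"
    using assms by (auto simp: differentiable_def)
  then have "linear f'" by (rule has_derivative_linear)
  then have "f' h = h \<bullet> adjoint f' 1" for h
    using adjoint_works[of f' h 1] by simp
  then have D: "GDERIV f x :> adjoint f' 1"
    using f' unfolding gderiv_def by (metis (no_types, lifting) has_derivative_eq_rhs ext)
  moreover have "D = adjoint f' 1" if "GDERIV f x :> D" for D
    using has_derivative_unique[OF that[unfolded gderiv_def] D[unfolded gderiv_def]]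
    by (metis vector_eq_ldot)
  ultimately show ?thesis
    unfolding gradient_def by (rule theI)
qed

text \<open>
  Restriction to the segment reduces the claim to the second-derivative test on the real line, for
  \<open>f\<close> minus the quadratic \<open>m / 2 * s\<^sup>2\<close>. The bound \<open>m\<close> may be negative: in directions where \<open>f\<close> is
  concave, the penalty term has to make up for the defect.
\<close>

lemma hessian_lower_bound_imp_strongly_convex_segment:
  fixes f :: "real ^ 'n \<Rightarrow> real"
  assumes W: "convex W" "x \<in> W" "y \<in> W"
    and f: "\<And>z. z \<in> W \<Longrightarrow> f differentiable (at z)"
    and grad: "\<And>z. z \<in> W \<Longrightarrow> gradient f differentiable (at z)"
    and hess: "\<And>z. z \<in> W \<Longrightarrow> m \<le> (x - y) \<bullet> (hessian f z *v (x - y))"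
    and t: "0 \<le> t" "t \<le> 1"
  shows "f ((1 - t) *\<^sub>R x + t *\<^sub>R y) \<le> (1 - t) * f x + t * f y - m / 2 * t * (1 - t)"
proof -
  define v where "v = x - y"
  have line: "((\<lambda>s. y + s *\<^sub>R v) has_derivative (\<lambda>h. h *\<^sub>R v)) (at s)" for s
    by (auto intro!: derivative_eq_intros)
  have inW: "y + s *\<^sub>R v \<in> W" if "s \<in> {0..1}" for s
  proof -
    have "y + s *\<^sub>R v = (1 - s) *\<^sub>R y + s *\<^sub>R x" by (simp add: v_def algebra_simps)
    then show ?thesis using W that by (simp add: convex_alt)
  qed
  define \<psi> where "\<psi> s = f (y + s *\<^sub>R v) - m / 2 * s\<^sup>2" for s
  have "convex_on {0..1} \<psi>"
  proof (rule f''_ge0_imp_convex)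
    fix s :: real assume s: "s \<in> {0..1}"
    have "(f has_derivative (\<lambda>h. h \<bullet> gradient f (y + s *\<^sub>R v))) (at (y + s *\<^sub>R v))"
      using GDERIV_gradient[OF f[OF inW[OF s]]] by (simp add: gderiv_def)
    from has_derivative_compose[OF line this]
    have "((\<lambda>s. f (y + s *\<^sub>R v)) has_real_derivative v \<bullet> gradient f (y + s *\<^sub>R v)) (at s)"
      by (simp add: has_field_derivative_def mult_commute_abs)
    then show "(\<psi> has_real_derivative v \<bullet> gradient f (y + s *\<^sub>R v) - m * s) (at s)"
      unfolding \<psi>_def by (auto intro!: derivative_eq_intros)
    have "(gradient f has_derivative (\<lambda>h. hessian f (y + s *\<^sub>R v) *v h)) (at (y + s *\<^sub>R v))"
      using grad[OF inW[OF s]] by (simp add: hessian_def jacobian_works)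
    from has_derivative_inner_right[OF has_derivative_compose[OF line this], of v]
    have "((\<lambda>s. v \<bullet> gradient f (y + s *\<^sub>R v)) has_real_derivative
        v \<bullet> (hessian f (y + s *\<^sub>R v) *v v)) (at s)"
      by (simp add: has_field_derivative_def mult_commute_abs matrix_vector_mult_scaleR)
    then show "((\<lambda>s. v \<bullet> gradient f (y + s *\<^sub>R v) - m * s) has_real_derivative
        v \<bullet> (hessian f (y + s *\<^sub>R v) *v v) - m) (at s)"
      by (auto intro!: derivative_eq_intros)
    show "0 \<le> v \<bullet> (hessian f (y + s *\<^sub>R v) *v v) - m"
      using hess[OF inW[OF s]] by (simp add: v_def)
  qed simp
  from convex_onD[OF this, of "1 - t" 0 1]
  have "\<psi> (1 - t) \<le> t * \<psi> 0 + (1 - t) * \<psi> 1" using t by simp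
  moreover have "y + (1 - t) *\<^sub>R v = (1 - t) *\<^sub>R x + t *\<^sub>R y" "y + v = x"
    by (simp_all add: v_def algebra_simps)
  ultimately have "f ((1 - t) *\<^sub>R x + t *\<^sub>R y) - m / 2 * (1 - t)\<^sup>2 \<le> t * f y + (1 - t) * (f x - m / 2)"
    by (simp add: \<psi>_def)
  then show ?thesis
    by (simp add: power2_eq_square field_simps)
qed

lemma norm_matrix_vector_mult_le_card:
  fixes B :: "real ^ 'n ^ 'm"
  shows "norm (B *v v) \<le> CARD('m) * (norm B * norm v)"
proof -
  have "\<bar>(B *v v) $ i\<bar> \<le> norm B * norm v" for i
  proof -
    have "\<bar>(B *v v) $ i\<bar> \<le> norm (B $ i) * norm v"
      unfolding matrix_vector_mul_component by (rule Cauchy_Schwarz_ineq2)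
    also have "\<dots> \<le> norm B * norm v"
      by (intro mult_right_mono Finite_Cartesian_Product.norm_nth_le) auto
    finally show ?thesis .
  qed
  then have "(\<Sum>i\<in>UNIV. \<bar>(B *v v) $ i\<bar>) \<le> CARD('m) * (norm B * norm v)"
    by (intro sum_bounded_above) auto
  then show ?thesis
    using norm_le_l1_cart[of "B *v v"] by linarith
qed

text \<open>
  The estimate is uniform in \<open>v\<close>; this is what allows one neighbourhood for all directions.
\<close>

lemma quadratic_form_lower_semicontinuous:
  fixes H :: "real ^ 'm \<Rightarrow> real ^ 'n ^ 'n"
  assumes H: "continuous_on U H" and x: "x \<in> interior U" and e: "0 < e"
  obtains \<rho> where "0 < \<rho>" "ball x \<rho> \<subseteq> U"
    "\<And>z v. z \<in> ball x \<rho> \<Longrightarrow> v \<bullet> (H x *v v) - e * (norm v)\<^sup>2 \<le> v \<bullet> (H z *v v)"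
proof -
  obtain \<rho>1 where \<rho>1: "0 < \<rho>1" "ball x \<rho>1 \<subseteq> U"
    using x by (auto simp: mem_interior)
  let ?e = "e / CARD('n)"
  have e': "0 < ?e" using e by simp
  have "x \<in> U" using \<rho>1 by auto
  then obtain \<rho>2 where \<rho>2: "0 < \<rho>2" "\<And>z. z \<in> U \<Longrightarrow> dist z x < \<rho>2 \<Longrightarrow> dist (H z) (H x) < ?e"
    using H e' unfolding continuous_on_iff by metis
  show ?thesis
  proof (rule that[of "min \<rho>1 \<rho>2"])
    show "0 < min \<rho>1 \<rho>2" "ball x (min \<rho>1 \<rho>2) \<subseteq> U" using \<rho>1 \<rho>2 by auto
    fix z v assume z: "z \<in> ball x (min \<rho>1 \<rho>2)"
    have "norm (H x - H z) \<le> ?e"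
      using \<rho>2(2)[of z] z \<rho>1 by (auto simp: dist_norm dist_commute norm_minus_commute)
    have "v \<bullet> ((H x - H z) *v v) \<le> norm v * norm ((H x - H z) *v v)"
      by (rule norm_cauchy_schwarz)
    also have "\<dots> \<le> norm v * (CARD('n) * (norm (H x - H z) * norm v))"
      by (intro mult_left_mono norm_matrix_vector_mult_le_card) auto
    also have "\<dots> \<le> norm v * (CARD('n) * (?e * norm v))"
      using \<open>norm (H x - H z) \<le> ?e\<close> by (intro mult_left_mono mult_right_mono) auto
    also have "\<dots> = e * (norm v)\<^sup>2" by (simp add: power2_eq_square)
    finally show "v \<bullet> (H x *v v) - e * (norm v)\<^sup>2 \<le> v \<bullet> (H z *v v)"
      by (simp add: matrix_vector_mult_diff_rdistrib inner_diff_right)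
  qed
qed

section \<open>Penalization of a quadratic form\<close>

text \<open>
  The compactness argument behind Finsler's lemma.
\<close>

lemma exact_penalization_on_compact:
  fixes h p :: "'a::metric_space \<Rightarrow> real"
  assumes K: "compact K" and h: "continuous_on K h" and p: "continuous_on K p"
    and p0: "\<And>v. v \<in> K \<Longrightarrow> 0 \<le> p v" and pos: "\<And>v. v \<in> K \<Longrightarrow> p v = 0 \<Longrightarrow> 0 < h v"
  shows "\<exists>\<beta>0. \<exists>c>0. \<forall>\<beta>\<ge>\<beta>0. \<forall>v\<in>K. c \<le> h v + \<beta> * p v"
proof -
  \<comment> \<open>On the compact set where \<open>h \<le> 0\<close> the penalty is bounded away from \<open>0\<close>, so a large multiple of it
    outweighs the minimum of \<open>h\<close>; elsewhere \<open>h\<close> is already positive.\<close>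
  obtain \<beta>0 where \<beta>0: "0 \<le> \<beta>0" "\<And>v. v \<in> K \<Longrightarrow> 0 < h v + \<beta>0 * p v"
  proof -
    let ?N = "{v \<in> K. h v \<le> 0}"
    have N: "compact ?N"
    proof -
      have "closed ?N"
        by (intro continuous_on_closed_Collect_le h continuous_on_const compact_imp_closed K)
      moreover have "?N = K \<inter> ?N" by auto
      ultimately show ?thesis using K by (metis compact_Int_closed)
    qed
    show ?thesis
    proof (cases "?N = {}")
      case True
      then have "0 < h v + 0 * p v" if "v \<in> K" for v
        using that by force
      then show ?thesis using that[of 0] by blast
    next
      case False
      obtain v1 where v1: "v1 \<in> ?N" "\<And>v. v \<in> ?N \<Longrightarrow> p v1 \<le> p v"
        using continuous_attains_inf[OF N False continuous_on_subset[OF p]] by blast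
      obtain v2 where v2: "v2 \<in> ?N" "\<And>v. v \<in> ?N \<Longrightarrow> h v2 \<le> h v"
        using continuous_attains_inf[OF N False continuous_on_subset[OF h]] by blast
      have p1: "0 < p v1"
        using v1(1) p0[of v1] pos[of v1] by force
      define \<beta>0 where "\<beta>0 = (1 - h v2) / p v1"
      have \<beta>0: "0 \<le> \<beta>0" using v2(1) p1 by (simp add: \<beta>0_def)
      have "0 < h v + \<beta>0 * p v" if v: "v \<in> K" for v
      proof (cases "h v \<le> 0")
        case True
        then have "v \<in> ?N" using v by simp
        then have "\<beta>0 * p v1 \<le> \<beta>0 * p v" "h v2 \<le> h v"
          using v1 v2 \<beta>0 by (auto intro: mult_left_mono)
        moreover have "\<beta>0 * p v1 = 1 - h v2" using p1 by (simp add: \<beta>0_def)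
        ultimately show ?thesis by linarith
      next
        case False
        then show ?thesis using \<beta>0 p0[OF v] by (simp add: add_pos_nonneg)
      qed
      then show ?thesis using that \<beta>0 by blast
    qed
  qed
  show ?thesis
  proof (cases "K = {}")
    case True
    then show ?thesis by (auto intro!: exI[of _ 0] exI[of _ 1])
  next
    case False
    have "continuous_on K (\<lambda>v. h v + \<beta>0 * p v)"
      by (intro continuous_intros h p)
    from continuous_attains_inf[OF K False this]
    obtain w where w: "w \<in> K" "\<And>v. v \<in> K \<Longrightarrow> h w + \<beta>0 * p w \<le> h v + \<beta>0 * p v" by blast
    show ?thesis
    proof (rule exI[of _ \<beta>0], rule exI[of _ "h w + \<beta>0 * p w"], intro conjI allI impI ballI)
      show "0 < h w + \<beta>0 * p w" using \<beta>0 w by blast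
      fix \<beta> v assume "\<beta>0 \<le> \<beta>" "v \<in> K"
      then have "\<beta>0 * p v \<le> \<beta> * p v" using p0 by (intro mult_right_mono)
      then show "h w + \<beta>0 * p w \<le> h v + \<beta> * p v" using w(2)[OF \<open>v \<in> K\<close>] by linarith
    qed
  qed
qed

text \<open>
  Finsler's lemma in the form used for augmented Lagrangians, with the squared distance of \<open>A *v v\<close> to
  a subspace as penalty. Compactness of the unit sphere gives it for unit vectors; both sides are
  homogeneous of degree two.
\<close>

lemma finsler_penalization:
  fixes H :: "real ^ 'n ^ 'n" and A :: "real ^ 'n ^ 'm"
  assumes V: "subspace V" and S: "subspace S"
    and pos: "\<And>v. v \<in> V \<Longrightarrow> A *v v \<in> S \<Longrightarrow> v \<noteq> 0 \<Longrightarrow> 0 < v \<bullet> (H *v v)"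
  shows "\<exists>\<beta>0. \<exists>c>0. \<forall>\<beta>\<ge>\<beta>0. 0 \<le> \<beta> \<longrightarrow>
    (\<forall>v\<in>V. c * (norm v)\<^sup>2 \<le> v \<bullet> (H *v v) + \<beta> * (infdist (A *v v) S)\<^sup>2)"
proof -
  let ?K = "sphere 0 1 \<inter> V"
  have K: "compact ?K"
    using closed_subspace[OF V] by (simp add: compact_Int_closed)
  have Sc: "closed S" "S \<noteq> {}"
    using closed_subspace[OF S] subspace_0[OF S] by auto
  have c1: "continuous_on ?K (\<lambda>v. v \<bullet> (H *v v))"
    by (intro continuous_intros matrix_vector_mult_linear_continuous_on)
  have c2: "continuous_on ?K (\<lambda>v. (infdist (A *v v) S)\<^sup>2)"
    by (intro continuous_intros matrix_vector_mult_linear_continuous_on)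
  have pos': "0 < v \<bullet> (H *v v)" if "v \<in> ?K" "(infdist (A *v v) S)\<^sup>2 = 0" for v
  proof -
    have "A *v v \<in> S" using that(2) Sc by (simp add: in_closed_iff_infdist_zero)
    then show ?thesis using that(1) pos[of v] by (cases "v = 0") auto
  qed
  obtain \<beta>0 c where c: "0 < c" "\<And>\<beta> v. \<beta>0 \<le> \<beta> \<Longrightarrow> v \<in> ?K \<Longrightarrow>
      c \<le> v \<bullet> (H *v v) + \<beta> * (infdist (A *v v) S)\<^sup>2"
    using exact_penalization_on_compact[OF K c1 c2 zero_le_power2 pos'] by metis
  show ?thesis
  proof (rule exI[of _ \<beta>0], rule exI[of _ c], intro conjI c(1) allI impI ballI)
    fix \<beta> v assume \<beta>: "\<beta>0 \<le> \<beta>" "0 \<le> \<beta>" and v: "v \<in> V"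
    show "c * (norm v)\<^sup>2 \<le> v \<bullet> (H *v v) + \<beta> * (infdist (A *v v) S)\<^sup>2"
    proof (cases "v = 0")
      case True
      then show ?thesis using \<beta> by simp
    next
      case False
      define n where "n = norm v"
      have n: "0 < n" using False by (simp add: n_def)
      define w where "w = (1 / n) *\<^sub>R v"
      have w: "w \<in> ?K" "v = n *\<^sub>R w"
        using n v V by (auto simp: w_def n_def subspace_scale)
      have "infdist (A *v w) S \<le> 1 / n * infdist (A *v v) S"
        using infdist_subspace_scaleR_le[OF S, of "1 / n" "A *v v"] n
        by (simp add: w_def matrix_vector_mult_scaleR)
      then have "n * infdist (A *v w) S \<le> infdist (A *v v) S"
        using n by (simp add: field_simps)
      then have "(n * infdist (A *v w) S)\<^sup>2 \<le> (infdist (A *v v) S)\<^sup>2"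
        using n by (intro power_mono) (auto simp: infdist_nonneg)
      then have le: "\<beta> * (n * infdist (A *v w) S)\<^sup>2 \<le> \<beta> * (infdist (A *v v) S)\<^sup>2"
        using \<beta> by (intro mult_left_mono)
      have "n\<^sup>2 * c \<le> n\<^sup>2 * (w \<bullet> (H *v w) + \<beta> * (infdist (A *v w) S)\<^sup>2)"
        using c(2)[OF \<beta>(1) w(1)] by (intro mult_left_mono) auto
      also have "\<dots> = v \<bullet> (H *v v) + \<beta> * (n * infdist (A *v w) S)\<^sup>2"
        by (subst (1 2) w(2)) (simp add: matrix_vector_mult_scaleR power2_eq_square algebra_simps)
      also note le
      finally show ?thesis by (simp add: n_def mult.commute)
    qed
  qed
qed

section \<open>Convexity of extended-valued functions through finite values\<close>

text \<open>
  Pairs with an end point outside \<open>C\<close> satisfy the inequality because the right-hand side is \<open>\<infinity>\<close>,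
  so that only the finite values on \<open>C\<close> matter.
\<close>

lemma ext_strongly_convex_onI:
  fixes h :: "'a::real_normed_vector \<Rightarrow> ereal"
  assumes X: "convex X" and C: "convex C" and \<sigma>: "0 < \<sigma>"
    and real: "\<And>x. x \<in> X \<Longrightarrow> x \<in> C \<Longrightarrow> h x = ereal (q x)"
    and infty: "\<And>x. x \<in> X \<Longrightarrow> x \<notin> C \<Longrightarrow> h x = \<infinity>"
    and q: "\<And>x y t. x \<in> X \<inter> C \<Longrightarrow> y \<in> X \<inter> C \<Longrightarrow> 0 < t \<Longrightarrow> t < 1 \<Longrightarrow>
      q ((1 - t) *\<^sub>R x + t *\<^sub>R y) \<le> (1 - t) * q x + t * q y - \<sigma> / 2 * t * (1 - t) * (norm (x - y))\<^sup>2"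
  shows "ext_strongly_convex_on X h"
  unfolding ext_strongly_convex_on_def
proof (intro conjI X exI[of _ \<sigma>] \<sigma> ballI allI impI, elim conjE)
  fix x y and t :: real
  assume x: "x \<in> X" and y: "y \<in> X" and t: "0 < t" "t < 1"
  show "h ((1 - t) *\<^sub>R x + t *\<^sub>R y)
      \<le> ereal (1 - t) * h x + ereal t * h y - ereal (\<sigma> / 2 * t * (1 - t) * (norm (x - y))\<^sup>2)"
  proof (cases "x \<in> C \<and> y \<in> C")
    case True
    then have "(1 - t) *\<^sub>R x + t *\<^sub>R y \<in> X" "(1 - t) *\<^sub>R x + t *\<^sub>R y \<in> C"
      using X C x y t by (auto simp: convex_alt)
    then show ?thesis
      using True x y t q[of x y t] by (simp add: real)
  next
    case False
    have "h x = \<infinity> \<or> h y = \<infinity>"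
      using False x y infty by blast
    moreover have "h z \<noteq> -\<infinity>" if "z \<in> X" for z
      using that real[of z] infty[of z] by (cases "z \<in> C") auto
    ultimately have "h x = \<infinity> \<or> h y = \<infinity>" "h x \<noteq> -\<infinity>" "h y \<noteq> -\<infinity>"
      using x y by auto
    then show ?thesis
      using t by (cases "h x"; cases "h y") auto
  qed
qed

lemma ext_concave_onI:
  fixes h :: "'a::real_vector \<Rightarrow> ereal"
  assumes L: "convex L" and real: "\<And>x. x \<in> L \<Longrightarrow> h x = ereal (q x)"
    and q: "\<And>x y t. x \<in> L \<Longrightarrow> y \<in> L \<Longrightarrow> 0 < t \<Longrightarrow> t < 1 \<Longrightarrow>
      (1 - t) * q x + t * q y \<le> q ((1 - t) *\<^sub>R x + t *\<^sub>R y)"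
  shows "ext_concave_on L h"
  unfolding ext_concave_on_def ext_convex_on_def
proof (intro conjI L ballI allI impI, elim conjE)
  fix x y and t :: real
  assume x: "x \<in> L" and y: "y \<in> L" and t: "0 < t" "t < 1"
  then have "(1 - t) *\<^sub>R x + t *\<^sub>R y \<in> L"
    using L by (auto simp: convex_alt)
  then show "- h ((1 - t) *\<^sub>R x + t *\<^sub>R y) \<le> ereal (1 - t) * - h x + ereal t * - h y"
    using x y t q[of x y t] by (simp add: real algebra_simps)
qed

section \<open>Strong variational sufficiency\<close>

theorem proposition7:
  fixes A :: "real ^ 'n ^ 'm"
    and C :: "(real ^ 'n) set"
    and f :: "real ^ 'n \<Rightarrow> real"
    and g :: "real ^ 'm \<Rightarrow> ereal"
    and xb :: "real ^ 'n"
    and lb :: "real ^ 'm"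
    and U :: "(real ^ 'n) set"
  assumes C: "C \<noteq> {}" "closed C" "convex C"
    and f: "continuously_differentiable f"
    and g: "\<And>y. g y \<noteq> -\<infinity>" "polyhedral_convex g"
    and qualification: "ext_dom g \<inter> (\<lambda>x. A *v x) ` rel_interior C \<noteq> {}"
    and first_order: "first_order_condition f g A C xb lb"
    and U: "convex U" "xb \<in> interior U"
    and hessian_exists: "\<And>x. x \<in> U \<Longrightarrow> gradient f differentiable (at x)"
    and hessian_continuous: "continuous_on U (hessian f)"
    and second_order: "pos_def_relative (hessian f xb) (parallel_space C \<inter> S_A_space g A xb lb)"
  shows "strong_variational_sufficiency f g A C xb lb"
proof -
  have sub: "lb \<in> subdifferential g (A *v xb)"
    using first_order by (simp add: first_order_condition_def)
  then obtain g0 where g0: "g (A *v xb) = ereal g0"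
    by (auto simp: subdifferential_def)
  obtain Z K r where Z: "compact Z" "convex Z" "0 \<in> Z" and K: "0 \<le> K" and r: "0 < r"
    and gZ: "\<And>z. z \<in> Z \<Longrightarrow> g (A *v xb + z) = ereal (g0 + lb \<bullet> z)"
    and growth: "\<And>u t. norm u \<le> r \<Longrightarrow> t \<le> r \<Longrightarrow> g (A *v xb + u) = ereal (g0 + lb \<bullet> u + t)
      \<Longrightarrow> infdist u Z \<le> K * t"
    using g(2) polyhedral_local_growth[OF _ g0 sub] unfolding polyhedral_convex_def by blast
  have Zc: "closed Z" "Z \<noteq> {}" using Z by (auto simp: compact_imp_closed)
  obtain x0 where x0: "x0 \<in> C" using C by blast
  have V: "subspace (parallel_space C)"
    unfolding parallel_space_eq[OF x0]
    using affine_diffs_subspace_subtract[OF affine_affine_hull hull_inc[OF x0]] .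
  have diff_V: "x - y \<in> parallel_space C" if "x \<in> C" "y \<in> C" for x y
    using that by (simp add: parallel_space_eq[of y] hull_inc)
  define H where "H = hessian f xb"
  have "0 < v \<bullet> (H *v v)" if "v \<in> parallel_space C" "A *v v \<in> span Z" "v \<noteq> 0" for v
    using second_order span_critical_set_subset_S_space[OF Z(2,3) g0 gZ] that
    by (auto simp: pos_def_relative_def S_A_space_def H_def)
  then obtain \<beta>0 c where c: "0 < c" and fin: "\<And>\<beta> v. \<beta>0 \<le> \<beta> \<Longrightarrow> 0 \<le> \<beta> \<Longrightarrow> v \<in> parallel_space C \<Longrightarrow>
      c * (norm v)\<^sup>2 \<le> v \<bullet> (H *v v) + \<beta> * (infdist (A *v v) (span Z))\<^sup>2"
    using finsler_penalization[OF V subspace_span, of A Z H] by metis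
  obtain \<rho> where \<rho>: "0 < \<rho>" "ball xb \<rho> \<subseteq> U"
    and hess: "\<And>z v. z \<in> ball xb \<rho> \<Longrightarrow>
      v \<bullet> (H *v v) - c / 2 * (norm v)\<^sup>2 \<le> v \<bullet> (hessian f z *v v)"
    using quadratic_form_lower_semicontinuous[OF hessian_continuous U(2), of "c / 2"] c
    unfolding H_def by auto
  have diff_f: "f differentiable (at z)" for z
    using f by (simp add: continuously_differentiable_def)
  \<comment> \<open>The neighbourhood may shrink with \<open>\<beta>\<close>: the formula for the envelope holds only at displacements
    of order \<open>1 / \<beta>\<close>.\<close>
  have "\<exists>X L. convex (X \<times> L) \<and> (xb, lb) \<in> interior (X \<times> L) \<and>
      (\<forall>l\<in>L. ext_strongly_convex_on X (\<lambda>x. aug_lagrangian f g A C \<beta> x l)) \<and>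
      (\<forall>x\<in>X \<inter> C. ext_concave_on L (\<lambda>l. aug_lagrangian f g A C \<beta> x l))"
    if large: "max \<beta>0 1 \<le> \<beta>" for \<beta>
  proof -
    have \<beta>: "\<beta>0 \<le> \<beta>" "0 < \<beta>" using large by auto
    obtain \<eta> where \<eta>: "0 < \<eta>"
      "\<And>s. 0 \<le> s \<Longrightarrow> s \<le> \<eta> \<Longrightarrow> s \<le> r / 2 \<and> \<beta> / 2 * s\<^sup>2 \<le> r \<and> \<beta> * K * s \<le> 1"
      using small_radius_for_envelope[OF \<beta>(2) K r] by blast
    define N where "N = onorm ((*v) A)"
    have N: "0 \<le> N" "\<And>v. norm (A *v v) \<le> N * norm v"
      unfolding N_def by (auto intro!: onorm_pos_le onorm)
    define \<tau> where "\<tau> = min \<rho> (\<eta> / (2 * (N + 1)))"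
    have \<tau>: "0 < \<tau>" "\<tau> \<le> \<rho>" "N * \<tau> \<le> \<eta> / 2"
    proof -
      show "0 < \<tau>" "\<tau> \<le> \<rho>" using \<rho> \<eta>(1) N(1) by (auto simp: \<tau>_def)
      have "N * \<tau> \<le> N * (\<eta> / (2 * (N + 1)))" using N(1) by (intro mult_left_mono) (auto simp: \<tau>_def)
      also have "\<dots> \<le> \<eta> / 2" using N(1) \<eta>(1) by (simp add: field_simps)
      finally show "N * \<tau> \<le> \<eta> / 2" .
    qed
    define X where "X = ball xb \<tau>"
    define L where "L = ball lb (\<beta> * \<eta> / 2)"
    define d where "d x l = A *v (x - xb) + (1 / \<beta>) *\<^sub>R (l - lb)" for x l
    have d_small: "norm (d x l) \<le> \<eta>" if "x \<in> X" "l \<in> L" for x l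
    proof -
      have "norm (A *v (x - xb)) \<le> N * \<tau>"
        using that(1) N by (intro order_trans[OF N(2)] mult_left_mono)
          (auto simp: X_def dist_norm norm_minus_commute)
      moreover have "norm ((1 / \<beta>) *\<^sub>R (l - lb)) \<le> \<eta> / 2"
        using that(2) \<beta>(2)
        by (simp add: L_def dist_norm norm_minus_commute pos_divide_le_eq mult.commute del: scaleR_diff_right)
      ultimately show ?thesis
        unfolding d_def using norm_triangle_ineq[of "A *v (x - xb)" "(1 / \<beta>) *\<^sub>R (l - lb)"] \<tau>(3)
        by linarith
    qed
    define q where "q x l = f x + (g0 + lb \<bullet> d x l + (norm lb)\<^sup>2 / (2 * \<beta>)
      + \<beta> / 2 * (infdist (d x l) Z)\<^sup>2) - 1 / (2 * \<beta>) * (norm l)\<^sup>2" for x l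
    have envelope: "moreau_envelope \<beta> g (A *v x + (1 / \<beta>) *\<^sub>R l)
        = ereal (g0 + lb \<bullet> d x l + (norm lb)\<^sup>2 / (2 * \<beta>) + \<beta> / 2 * (infdist (d x l) Z)\<^sup>2)"
      if "x \<in> X" "l \<in> L" for x l
    proof -
      have "A *v x + (1 / \<beta>) *\<^sub>R l = A *v xb + (1 / \<beta>) *\<^sub>R lb + d x l"
        by (simp add: d_def matrix_vector_mult_diff_distrib scaleR_diff_right)
      then show ?thesis
        by (simp only:) (rule moreau_envelope_near_multiplier[OF g0 sub Zc(1) Z(3) K r gZ growth \<beta>(2)];
          use \<eta>(2)[OF norm_ge_zero d_small[OF that]] in blast)
    qed
    have real: "aug_lagrangian f g A C \<beta> x l = ereal (q x l)" if "x \<in> X" "x \<in> C" "l \<in> L" for x l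
      using that by (simp add: aug_lagrangian_def envelope delta_def q_def)
    have infty: "aug_lagrangian f g A C \<beta> x l = \<infinity>" if "x \<in> X" "x \<notin> C" "l \<in> L" for x l
      using that by (simp add: aug_lagrangian_def envelope delta_def)
    show ?thesis
    proof (intro exI[of _ X] exI[of _ L] conjI ballI)
      show "convex (X \<times> L)" by (simp add: X_def L_def convex_Times)
      show "(xb, lb) \<in> interior (X \<times> L)"
        using \<tau> \<beta> \<eta> by (simp add: X_def L_def interior_Times)
      show "ext_strongly_convex_on X (\<lambda>x. aug_lagrangian f g A C \<beta> x l)" if l: "l \<in> L" for l
      proof (rule ext_strongly_convex_onI[where C = C and \<sigma> = "c / 2" and q = "\<lambda>x. q x l"])
        fix x y and t :: real
        assume x: "x \<in> X \<inter> C" and y: "y \<in> X \<inter> C" and t: "0 < t" "t < 1"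
        let ?z = "(1 - t) *\<^sub>R x + t *\<^sub>R y"
        let ?v = "x - y"
        let ?m = "?v \<bullet> (H *v ?v) - c / 2 * (norm ?v)\<^sup>2"
        let ?D = "infdist (A *v ?v) (span Z)"
        have fz: "f ?z \<le> (1 - t) * f x + t * f y - ?m / 2 * t * (1 - t)"
        proof (rule hessian_lower_bound_imp_strongly_convex_segment[where W = "ball xb \<rho>"])
          show "x \<in> ball xb \<rho>" "y \<in> ball xb \<rho>" using x y \<tau>(2) by (auto simp: X_def)
        qed (use t diff_f hess hessian_exists \<rho>(2) in auto)
        have dz: "d ?z l = (1 - t) *\<^sub>R d x l + t *\<^sub>R d y l"
        proof -
          have "?z - xb = (1 - t) *\<^sub>R (x - xb) + t *\<^sub>R (y - xb)"
            by (simp add: algebra_simps)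
          then have "A *v (?z - xb) = (1 - t) *\<^sub>R (A *v (x - xb)) + t *\<^sub>R (A *v (y - xb))"
            by (simp only: matrix_vector_right_distrib matrix_vector_mult_scaleR)
          moreover have "(1 - t) *\<^sub>R (a + w) + t *\<^sub>R (b + w) = (1 - t) *\<^sub>R a + t *\<^sub>R b + w"
            for a b w :: "real ^ 'm"
            by (simp add: algebra_simps)
          ultimately show ?thesis by (simp only: d_def)
        qed
        have dv: "d x l - d y l = A *v ?v"
          by (simp add: d_def matrix_vector_mult_diff_distrib)
        have "(infdist (d ?z l) Z)\<^sup>2
            \<le> (1 - t) * (infdist (d x l) Z)\<^sup>2 + t * (infdist (d y l) Z)\<^sup>2 - t * (1 - t) * ?D\<^sup>2"
          unfolding dz dv[symmetric]
          using infdist_square_strongly_convex_modulo_span[OF Z(2) Zc] t by simp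
        then have dist: "\<beta> / 2 * (infdist (d ?z l) Z)\<^sup>2
            \<le> \<beta> / 2 * ((1 - t) * (infdist (d x l) Z)\<^sup>2 + t * (infdist (d y l) Z)\<^sup>2 - t * (1 - t) * ?D\<^sup>2)"
          using \<beta>(2) by (intro mult_left_mono) auto
        have lin: "lb \<bullet> d ?z l = (1 - t) * (lb \<bullet> d x l) + t * (lb \<bullet> d y l)"
          unfolding dz by (simp add: inner_add_right)
        have "F + (g0 + ez + n + \<beta> / 2 * Iz) - k
            \<le> (1 - t) * (fx + (g0 + ex + n + \<beta> / 2 * Ix) - k)
              + t * (fy + (g0 + ey + n + \<beta> / 2 * Iy) - k) - (m + \<beta> * D) / 2 * t * (1 - t)"
          if "F \<le> (1 - t) * fx + t * fy - m / 2 * t * (1 - t)"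
            "\<beta> / 2 * Iz \<le> \<beta> / 2 * ((1 - t) * Ix + t * Iy - t * (1 - t) * D)"
            "ez = (1 - t) * ex + t * ey"
          for F fx fy m Iz Ix Iy D ez ex ey n k :: real
          using that by (simp add: field_simps)
        from this[OF fz dist lin]
        have "q ?z l \<le> (1 - t) * q x l + t * q y l - (?m + \<beta> * ?D\<^sup>2) / 2 * t * (1 - t)"
          unfolding q_def .
        also have "\<dots> \<le> (1 - t) * q x l + t * q y l - c / 2 / 2 * t * (1 - t) * (norm ?v)\<^sup>2"
        proof -
          have "c * (norm ?v)\<^sup>2 \<le> ?v \<bullet> (H *v ?v) + \<beta> * ?D\<^sup>2"
            using fin[OF \<beta>(1) less_imp_le[OF \<beta>(2)] diff_V] x y by simp
          then have "c / 2 * (norm ?v)\<^sup>2 \<le> ?m + \<beta> * ?D\<^sup>2" by simp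
          then have "c / 2 * (norm ?v)\<^sup>2 * (t * (1 - t) / 2) \<le> (?m + \<beta> * ?D\<^sup>2) * (t * (1 - t) / 2)"
            using t by (intro mult_right_mono) auto
          then show ?thesis by (simp add: mult_ac)
        qed
        finally show "q ?z l \<le> (1 - t) * q x l + t * q y l
            - c / 2 / 2 * t * (1 - t) * (norm (x - y))\<^sup>2" .
      qed (use C c l real infty in \<open>auto simp: X_def\<close>)
      show "ext_concave_on L (\<lambda>l. aug_lagrangian f g A C \<beta> x l)" if x: "x \<in> X \<inter> C" for x
      proof (rule ext_concave_onI[where q = "q x"])
        fix l k :: "real ^ 'm" and t :: real
        assume t: "0 < t" "t < 1"
        let ?p = "(1 - t) *\<^sub>R l + t *\<^sub>R k"
        have dp: "d x ?p = (1 - t) *\<^sub>R d x l + t *\<^sub>R d x k"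
        proof -
          have "?p - lb = (1 - t) *\<^sub>R (l - lb) + t *\<^sub>R (k - lb)"
            by (simp add: algebra_simps)
          then have "(1 / \<beta>) *\<^sub>R (?p - lb)
              = (1 - t) *\<^sub>R ((1 / \<beta>) *\<^sub>R (l - lb)) + t *\<^sub>R ((1 / \<beta>) *\<^sub>R (k - lb))"
            by (simp only: scaleR_add_right scaleR_scaleR mult.commute)
          moreover have "(1 - t) *\<^sub>R (w + a) + t *\<^sub>R (w + b) = w + ((1 - t) *\<^sub>R a + t *\<^sub>R b)"
            for a b w :: "real ^ 'm"
            by (simp add: algebra_simps)
          ultimately show ?thesis by (simp only: d_def)
        qed
        have dv: "(norm (d x l - d x k))\<^sup>2 = (norm (l - k))\<^sup>2 / \<beta>\<^sup>2"
        proof -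
          have "d x l - d x k = (1 / \<beta>) *\<^sub>R (l - k)" by (simp add: d_def algebra_simps)
          then show ?thesis by (simp add: power_divide)
        qed
        have "(1 - t) * (infdist (d x l) Z)\<^sup>2 + t * (infdist (d x k) Z)\<^sup>2
            - t * (1 - t) * ((norm (l - k))\<^sup>2 / \<beta>\<^sup>2) \<le> (infdist (d x ?p) Z)\<^sup>2"
          unfolding dp dv[symmetric] using infdist_square_semiconcave[OF Zc] t by simp
        then have dist: "\<beta> / 2 * ((1 - t) * (infdist (d x l) Z)\<^sup>2 + t * (infdist (d x k) Z)\<^sup>2
            - t * (1 - t) * ((norm (l - k))\<^sup>2 / \<beta>\<^sup>2)) \<le> \<beta> / 2 * (infdist (d x ?p) Z)\<^sup>2"
          using \<beta>(2) by (intro mult_left_mono) auto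
        have lin: "lb \<bullet> d x ?p = (1 - t) * (lb \<bullet> d x l) + t * (lb \<bullet> d x k)"
          unfolding dp by (simp add: inner_add_right)
        \<comment> \<open>The loss of \<open>\<beta> / 2\<close> times the squared distance is exactly what the term
          \<open>- (norm l)\<^sup>2 / (2 * \<beta>)\<close> gives back.\<close>
        have "(1 - t) * (F + (g0 + el + n + \<beta> / 2 * Il) - 1 / (2 * \<beta>) * nl)
              + t * (F + (g0 + ek + n + \<beta> / 2 * Ik) - 1 / (2 * \<beta>) * nk)
            \<le> F + (g0 + ep + n + \<beta> / 2 * Ip) - 1 / (2 * \<beta>) * np"
          if "\<beta> / 2 * ((1 - t) * Il + t * Ik - t * (1 - t) * (D / \<beta>\<^sup>2)) \<le> \<beta> / 2 * Ip"
            "ep = (1 - t) * el + t * ek" "np = (1 - t) * nl + t * nk - t * (1 - t) * D"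
          for F el ek ep n Il Ik Ip nl nk np D :: real
        proof -
          have "\<beta> / 2 * (t * (1 - t) * (D / \<beta>\<^sup>2)) = 1 / (2 * \<beta>) * (t * (1 - t) * D)"
            using \<beta>(2) by (simp add: power2_eq_square)
          then have "\<beta> / 2 * ((1 - t) * Il + t * Ik) - 1 / (2 * \<beta>) * (t * (1 - t) * D) \<le> \<beta> / 2 * Ip"
            using that(1) by (simp only: right_diff_distrib)
          then show ?thesis
            unfolding that(2,3) by (simp only: ring_distribs mult.assoc mult.left_commute mult.commute)
        qed
        from this[OF dist lin norm_square_convex_combination]
        show "(1 - t) * q x l + t * q x k \<le> q x ?p"
          unfolding q_def .
      qed (use x real in \<open>auto simp: L_def\<close>)
    qed
  qed
  then show ?thesis
    unfolding strong_variational_sufficiency_def eventually_at_top_linorder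
    using first_order by blast
qed

end
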